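(* Let $A$ be a semi-simple commutative complex Banach algebra and let $T:A\to A$ be a multiplier of $A$. Then the following assertions are equivalent: (1) $T$ is Pseudo-Fredholm; (2) $T$ is left generalized Drazin invertible.
   Context: A mapping $T:A\to A$ is a multiplier of $A$ if $T(x)y=xT(y)$ for all $x,y\in A$; it is well known that every multiplier of a semi-simple commutative Banach algebra is a bounded linear operator on $A$. For a bounded operator $T$ on a Banach space $X$, $N(T)$, $R(T)$ are the null space and range, and $R^{\infty}(T)=\bigcap_{n\ge 0}R(T^n)$. $T$ is semi-regular (Kato) if $R(T)$ is closed and $N(T)\subseteq R^\infty(T)$. $T$ is Pseudo-Fredholm (admits a generalized Kato decomposition) if there are $T$-invariant closed subspaces $M,N$ with $X=M\oplus N$, $T|_M$ semi-regular and $T|_N$ quasinilpotent (here $M=\{0\}$ or $N=\{0\}$ is allowed). $H_0(T)=\{x\in X:\lim_{n}\|T^nx\|^{1/n}=0\}$ is the quasinilpotent part of $T$. $T$ is left generalized Drazin invertible if $H_0(T)$ is closed and there is a closed $T$-invariant subspace $M$ with $X=H_0(T)\oplus M$ and $T(M)$ closed. *)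

theory Defs
  imports "HOL-Analysis.Analysis" "HOL-Library.Set_Algebras"
begin

section \<open>Complex Banach algebras\<close>

text \<open>
  The analysis library only has classes for real scalars. The classes below add a complex scalar
  multiplication which extends the real one.
\<close>

class complex_vector = real_vector +
  fixes scaleC :: "complex \<Rightarrow> 'a \<Rightarrow> 'a" (infixr "*\<^sub>C" 75)
  assumes scaleC_add_right: "a *\<^sub>C (x + y) = a *\<^sub>C x + a *\<^sub>C y"
    and scaleC_add_left: "(a + b) *\<^sub>C x = a *\<^sub>C x + b *\<^sub>C x"
    and scaleC_scaleC: "a *\<^sub>C b *\<^sub>C x = (a * b) *\<^sub>C x"
    and scaleC_one: "1 *\<^sub>C x = x"
    and scaleR_scaleC: "r *\<^sub>R x = complex_of_real r *\<^sub>C x"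

interpretation complex_vector: vector_space "scaleC :: complex \<Rightarrow> 'a \<Rightarrow> 'a::complex_vector"
  by standard (rule scaleC_add_right scaleC_add_left scaleC_scaleC scaleC_one)+

class complex_normed_vector = complex_vector + real_normed_vector +
  assumes norm_scaleC: "norm (a *\<^sub>C x) = cmod a * norm x"

class complex_banach = complex_normed_vector + banach

text \<open>No unit is required; submultiplicativity of the norm comes from
  \<^class>\<open>real_normed_algebra\<close>.\<close>

class complex_banach_algebra = complex_banach + real_normed_algebra +
  assumes mult_scaleC_left: "(a *\<^sub>C x) * y = a *\<^sub>C (x * y)"
    and mult_scaleC_right: "x * (a *\<^sub>C y) = a *\<^sub>C (x * y)"

class comm_complex_banach_algebra = complex_banach_algebra + comm_ring


section \<open>Semi-simplicity and multipliers\<close>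

definition algebra_ideal :: "'a::comm_complex_banach_algebra set \<Rightarrow> bool" where
  "algebra_ideal I \<longleftrightarrow> complex_vector.subspace I \<and> (\<forall>a. \<forall>x\<in>I. a * x \<in> I)"

definition modular_ideal :: "'a::comm_complex_banach_algebra set \<Rightarrow> bool" where
  "modular_ideal I \<longleftrightarrow> algebra_ideal I \<and> (\<exists>e. \<forall>x. e * x - x \<in> I)"

definition maximal_modular_ideal :: "'a::comm_complex_banach_algebra set \<Rightarrow> bool" where
  "maximal_modular_ideal I \<longleftrightarrow>
     modular_ideal I \<and> I \<noteq> UNIV \<and> (\<forall>J. algebra_ideal J \<and> I \<subseteq> J \<longrightarrow> J = I \<or> J = UNIV)"

text \<open>The algebra may lack a unit, so the radical is formed with the modular maximal ideals.
  If there are none, the intersection is the whole algebra.\<close>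

definition jacobson_radical :: "'a::comm_complex_banach_algebra set" where
  "jacobson_radical = \<Inter> {I. maximal_modular_ideal I}"

definition semisimple :: "'a::comm_complex_banach_algebra itself \<Rightarrow> bool" where
  "semisimple _ \<longleftrightarrow> (jacobson_radical :: 'a set) = {0}"

text \<open>Linearity and boundedness are not part of the definition: they follow
  when the algebra is semi-simple.\<close>

definition multiplier :: "('a::comm_complex_banach_algebra \<Rightarrow> 'a) \<Rightarrow> bool" where
  "multiplier T \<longleftrightarrow> (\<forall>x y. T x * y = x * T y)"


section \<open>Decompositions of bounded operators\<close>

text \<open>
  The notions below are meant for a bounded linear operator \<open>T\<close>. The restriction of \<open>T\<close> to an
  invariant closed subspace \<open>M\<close> is represented by the pair \<open>M\<close>, \<open>T\<close>; its range is \<open>T ` M\<close>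
  and its powers are the restrictions of the powers of \<open>T\<close>. Since \<open>M\<close> is closed, closedness
  of \<open>T ` M\<close> in \<open>M\<close> and in the whole space agree.
\<close>

definition invariant_closed_subspace :: "('a::complex_banach \<Rightarrow> 'a) \<Rightarrow> 'a set \<Rightarrow> bool" where
  "invariant_closed_subspace T M \<longleftrightarrow> complex_vector.subspace M \<and> closed M \<and> T ` M \<subseteq> M"

definition is_direct_sum :: "'a::complex_banach set \<Rightarrow> 'a set \<Rightarrow> bool" where
  "is_direct_sum M N \<longleftrightarrow> M + N = UNIV \<and> M \<inter> N = {0}"

definition semi_regular_on :: "'a::complex_banach set \<Rightarrow> ('a \<Rightarrow> 'a) \<Rightarrow> bool" where
  "semi_regular_on M T \<longleftrightarrow>
     closed (T ` M) \<and> {x \<in> M. T x = 0} \<subseteq> (\<Inter>n. (T ^^ n) ` M)"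

text \<open>Operator norm of the restriction, in the form of \<^const>\<open>onorm\<close>; the
  quotient at \<open>0\<close> is \<open>0 / 0 = 0\<close>.\<close>

definition onorm_on :: "'a::complex_banach set \<Rightarrow> ('a \<Rightarrow> 'a) \<Rightarrow> real" where
  "onorm_on N T = (SUP x\<in>N. norm (T x) / norm x)"

text \<open>Quasinilpotent means spectral radius \<open>0\<close>. The zero operator on \<open>{0}\<close> qualifies.\<close>

definition quasinilpotent_on :: "'a::complex_banach set \<Rightarrow> ('a \<Rightarrow> 'a) \<Rightarrow> bool" where
  "quasinilpotent_on N T \<longleftrightarrow> (\<lambda>n. root n (onorm_on N (T ^^ n))) \<longlonglongrightarrow> 0"

definition pseudo_fredholm :: "('a::complex_banach \<Rightarrow> 'a) \<Rightarrow> bool" where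
  "pseudo_fredholm T \<longleftrightarrow>
     (\<exists>M N. invariant_closed_subspace T M \<and> invariant_closed_subspace T N \<and>
        is_direct_sum M N \<and> semi_regular_on M T \<and> quasinilpotent_on N T)"

definition quasinilpotent_part :: "('a::complex_banach \<Rightarrow> 'a) \<Rightarrow> 'a set" where
  "quasinilpotent_part T = {x. (\<lambda>n. root n (norm ((T ^^ n) x))) \<longlonglongrightarrow> 0}"

definition left_generalized_drazin_invertible :: "('a::complex_banach \<Rightarrow> 'a) \<Rightarrow> bool" where
  "left_generalized_drazin_invertible T \<longleftrightarrow>
     closed (quasinilpotent_part T) \<and>
     (\<exists>M. invariant_closed_subspace T M \<and> is_direct_sum (quasinilpotent_part T) M \<and>
        closed (T ` M))"

end

theory Submission
  imports Defs
begin

text \<open>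
  The equivalence rests on the identity \<open>H\<^sub>0(T) = N(T)\<close>, valid for every multiplier \<open>T\<close> of a
  semi-simple commutative Banach algebra (lemma \<open>quasinilpotent_part_multiplier\<close>). If \<open>x\<close> is in
  \<open>H\<^sub>0(T)\<close>, then \<open>(T x)\<^sup>n = T\<^sup>n x \<cdot> x\<^sup>n\<^sup>-\<^sup>1\<close>, so \<open>T x\<close> is a quasinilpotent element of the algebra;
  quasinilpotent elements lie in the Jacobson radical, hence \<open>T x = 0\<close>.

  Given a generalized Kato decomposition \<open>(M, N)\<close>, the subspace \<open>N\<close> is contained in
  \<open>H\<^sub>0(T) = N(T)\<close>. The kernel of \<open>T\<close> on \<open>M\<close> vanishes: by semi-regularity such an element has
  the form \<open>x = T y\<close>, and \<open>T (T y) = 0\<close> puts \<open>y\<close> in \<open>H\<^sub>0(T)\<close>, so that \<open>x = T y = 0\<close>. Therefore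
  \<open>H\<^sub>0(T) = N\<close> is closed and complemented by \<open>M\<close>. Conversely, if \<open>M\<close> is a closed invariant
  complement of \<open>H\<^sub>0(T) = N(T)\<close> with closed image, then \<open>T\<close> is injective on \<open>M\<close> and zero on
  \<open>H\<^sub>0(T)\<close>, so \<open>(M, H\<^sub>0(T))\<close> is a generalized Kato decomposition.

  That \<open>N \<subseteq> H\<^sub>0(T)\<close> uses the boundedness of \<open>T\<close>, which is a consequence of the closed graph
  theorem.
\<close>

section \<open>Growth of sequences and the quasinilpotent part\<close>

text \<open>Every estimate of spectral type below is a comparison up to a constant and a geometric
  factor, neither of which affects convergence of the roots to zero.\<close>

lemma root_tendsto_0_majorant:
  fixes f g :: "nat \<Rightarrow> real"
  assumes g: "(\<lambda>n. root n (g n)) \<longlonglongrightarrow> 0"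
    and nonneg: "\<And>n. 0 \<le> f n" "\<And>n. 0 \<le> g n"
    and le: "\<And>n. f n \<le> C * K ^ n * g n" and K: "0 \<le> K"
  shows "(\<lambda>n. root n (f n)) \<longlonglongrightarrow> 0"
proof (rule tendsto_sandwich)
  \<comment> \<open>The constant is made positive because the roots of \<open>0\<close> do not tend to \<open>1\<close>.\<close>
  define D where "D = \<bar>C\<bar> + 1"
  have D: "0 < D" "C \<le> D" by (auto simp: D_def)
  show "\<forall>\<^sub>F n in sequentially. 0 \<le> root n (f n)"
    using nonneg by (simp add: real_root_ge_zero)
  show "\<forall>\<^sub>F n in sequentially. root n (f n) \<le> root n D * K * root n (g n)"
  proof (rule eventually_mono[OF eventually_gt_at_top[of 0]])
    fix n :: nat assume n: "0 < n"
    have "C * K ^ n * g n \<le> D * K ^ n * g n"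
      using D K nonneg(2) by (intro mult_right_mono) auto
    then have "f n \<le> D * K ^ n * g n" using le[of n] by linarith
    then have "root n (f n) \<le> root n (D * K ^ n * g n)"
      using n by simp
    also have "\<dots> = root n D * K * root n (g n)"
      using n K by (simp add: real_root_mult real_root_power_cancel)
    finally show "root n (f n) \<le> root n D * K * root n (g n)" .
  qed
  show "(\<lambda>n. root n D * K * root n (g n)) \<longlonglongrightarrow> 0"
    using tendsto_mult[OF tendsto_mult[OF LIMSEQ_root_const[OF D(1)] tendsto_const[of K]] g]
    by simp
qed simp

lemma funpow_norm_le:
  fixes S :: "'a::real_normed_vector \<Rightarrow> 'a"
  assumes S: "\<And>x. norm (S x) \<le> K * norm x" and K: "0 \<le> K"
  shows "norm ((S ^^ n) x) \<le> K ^ n * norm x"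
proof (induction n)
  case (Suc n)
  have "norm ((S ^^ Suc n) x) \<le> K * norm ((S ^^ n) x)" using S by simp
  also have "\<dots> \<le> K * (K ^ n * norm x)" using Suc K by (rule mult_left_mono)
  finally show ?case by (simp add: mult.assoc)
qed simp

text \<open>If a bounded operator \<open>S\<close> commutes with \<open>T\<close>, then \<open>(S T)\<^sup>n = S\<^sup>n T\<^sup>n\<close> grows like \<open>T\<^sup>n\<close> up to
  a geometric factor.\<close>

lemma quasinilpotent_part_compose:
  fixes S T :: "'a::complex_banach \<Rightarrow> 'a"
  assumes x: "x \<in> quasinilpotent_part T"
    and comm: "\<And>y. S (T y) = T (S y)"
    and S: "\<And>y. norm (S y) \<le> K * norm y" and K: "0 \<le> K"
  shows "x \<in> quasinilpotent_part (\<lambda>y. S (T y))"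
proof -
  have eq: "((\<lambda>y. S (T y)) ^^ n) y = (S ^^ n) ((T ^^ n) y)" for n y
  proof (induction n)
    case (Suc n)
    have "T ((S ^^ n) z) = (S ^^ n) (T z)" for z
      by (induction n) (simp_all flip: comm)
    then show ?case using Suc by simp
  qed simp
  show ?thesis
    using x unfolding quasinilpotent_part_def mem_Collect_eq
    by (rule root_tendsto_0_majorant[where C = 1 and K = K])
      (use funpow_norm_le[of S, OF S K] K in \<open>auto simp: eq\<close>)
qed

lemma quasinilpotent_part_image:
  fixes S T :: "'a::complex_banach \<Rightarrow> 'a"
  assumes x: "x \<in> quasinilpotent_part T"
    and comm: "\<And>y. S (T y) = T (S y)"
    and S: "\<And>y. norm (S y) \<le> K * norm y"
  shows "S x \<in> quasinilpotent_part T"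
proof -
  have commn: "(T ^^ n) (S y) = S ((T ^^ n) y)" for n y
    by (induction n) (simp_all add: comm)
  show ?thesis
    using x unfolding quasinilpotent_part_def mem_Collect_eq
    by (rule root_tendsto_0_majorant[where C = K and K = 1]) (use S in \<open>auto simp: commn\<close>)
qed

lemma summable_if_root_tendsto_0:
  fixes f :: "nat \<Rightarrow> 'a::banach"
  assumes "(\<lambda>n. root n (norm (f n))) \<longlonglongrightarrow> 0"
  shows "summable f"
proof (rule root_test_convergence')
  have "(\<lambda>n. ereal (root n (norm (f n)))) \<longlonglongrightarrow> ereal 0"
    using assms by (simp only: lim_ereal)
  from lim_imp_Limsup[OF _ this] show "limsup (\<lambda>n. ereal (root n (norm (f n)))) < 1"
    by simp
qed

lemma funpow_eq_zero:
  fixes T :: "'a::zero \<Rightarrow> 'a"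
  assumes "T 0 = 0" "T x = 0" "0 < n"
  shows "(T ^^ n) x = 0"
proof -
  have "(T ^^ m) 0 = 0" for m by (induction m) (simp_all add: assms)
  then show ?thesis using assms by (cases n) (simp_all add: funpow_swap1)
qed

lemma nilpotent_in_quasinilpotent_part:
  fixes T :: "'a::complex_banach \<Rightarrow> 'a"
  assumes "T 0 = 0" "T (T x) = 0"
  shows "x \<in> quasinilpotent_part T"
proof -
  have "\<forall>\<^sub>F n in sequentially. root n (norm ((T ^^ n) x)) = 0"
  proof (rule eventually_mono[OF eventually_gt_at_top[of 1]])
    fix n :: nat assume "1 < n"
    then obtain m where "n = Suc m" "0 < m" by (cases n) auto
    then show "root n (norm ((T ^^ n) x)) = 0"
      using funpow_eq_zero[of T "T x" m] assms by (simp add: funpow_swap1)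
  qed
  then show ?thesis
    unfolding quasinilpotent_part_def by (simp add: tendsto_eventually)
qed

section \<open>Quasinilpotent elements lie in the radical\<close>

text \<open>
  In the absence of a unit, the condition \<open>a \<in> quasinilpotent_part ((*) a)\<close> expresses that \<open>a\<close>
  is quasinilpotent: \<open>((*) a ^^ n) a\<close> is the power \<open>a\<^sup>n\<^sup>+\<^sup>1\<close>. The solution \<open>y = q + q\<^sup>2 + \<dots>\<close>
  below plays the role of \<open>(1 - q)\<^sup>-\<^sup>1 - 1\<close>.
\<close>

lemma quasinilpotent_imp_quasiregular:
  fixes q :: "'a::comm_complex_banach_algebra"
  assumes "q \<in> quasinilpotent_part ((*) q)"
  obtains y where "q = y - y * q"
proof -
  let ?f = "\<lambda>n. ((*) q ^^ n) q"
  have sm: "summable ?f"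
    using assms unfolding quasinilpotent_part_def
    by (intro summable_if_root_tendsto_0) simp
  have "q * suminf ?f = (\<Sum>n. ?f (Suc n))"
    using suminf_mult[OF sm, of q] by simp
  also have "\<dots> = suminf ?f - q"
    using suminf_split_head[OF sm] by simp
  finally have "q = suminf ?f - suminf ?f * q"
    by (simp add: mult.commute)
  then show ?thesis by (rule that)
qed

text \<open>A proper ideal with modular unit \<open>e\<close> cannot contain \<open>e - q\<close> for a quasi-regular \<open>q\<close>,
  because \<open>e\<close> acts as a unit in the quotient and \<open>1 - q\<close> would be both zero and invertible
  there.\<close>

lemma ideal_UNIV_if_quasiregular:
  fixes e q :: "'a::comm_complex_banach_algebra"
  assumes I: "algebra_ideal I" and e: "\<And>x. e * x - x \<in> I"
    and eq: "e - q \<in> I" and y: "q = y - y * q"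
  shows "I = UNIV"
proof -
  have sub: "complex_vector.subspace I" and mult: "\<And>a x. x \<in> I \<Longrightarrow> a * x \<in> I"
    using I by (auto simp: algebra_ideal_def)
  note add = complex_vector.subspace_add[OF sub] and diff = complex_vector.subspace_diff[OF sub]
  have "y * (e - q) - (e * y - y) = q"
    using y by (simp add: algebra_simps)
  then have "q \<in> I"
    using diff[OF mult[OF eq] e] by metis
  then have "e \<in> I"
    using add[OF eq, of q] by simp
  then have "x \<in> I" for x
    using diff[OF mult[of e x] e[of x]] by (simp add: mult.commute)
  then show ?thesis by auto
qed

text \<open>If a maximal modular ideal \<open>I\<close> missed the quasinilpotent element \<open>a\<close>, then \<open>I\<close> and \<open>a\<close>
  would generate the whole algebra, so the modular unit would be congruent modulo \<open>I\<close> to a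
  multiple of \<open>a\<close>; that multiple is again quasinilpotent, hence quasi-regular.\<close>

lemma quasinilpotent_in_jacobson_radical:
  fixes a :: "'a::comm_complex_banach_algebra"
  assumes a: "a \<in> quasinilpotent_part ((*) a)"
  shows "a \<in> jacobson_radical"
  unfolding jacobson_radical_def
proof (clarify, rule ccontr)
  fix I :: "'a set"
  assume max: "maximal_modular_ideal I" and "a \<notin> I"
  from max have I: "algebra_ideal I" and proper: "I \<noteq> UNIV"
    by (auto simp: maximal_modular_ideal_def modular_ideal_def)
  from max obtain e where e: "\<And>x. e * x - x \<in> I"
    by (auto simp: maximal_modular_ideal_def modular_ideal_def)
  have sub: "complex_vector.subspace I" and mult: "\<And>a x. x \<in> I \<Longrightarrow> a * x \<in> I"
    using I by (auto simp: algebra_ideal_def)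
  define J where "J = {i + c *\<^sub>C a + b * a | i b c. i \<in> I}"
  have JI: "i + c *\<^sub>C a + b * a \<in> J" if "i \<in> I" for i b c
    using that by (auto simp: J_def)
  have "algebra_ideal J"
    unfolding algebra_ideal_def
  proof (intro conjI complex_vector.subspaceI allI ballI)
    show "0 \<in> J"
      using JI[OF complex_vector.subspace_0[OF sub], of 0 0] by simp
  next
    fix x y assume "x \<in> J" "y \<in> J"
    then obtain i b c j b' c' where ij: "i \<in> I" "j \<in> I"
      and xy: "x = i + c *\<^sub>C a + b * a" "y = j + c' *\<^sub>C a + b' * a"
      by (auto simp: J_def)
    have "x + y = (i + j) + (c + c') *\<^sub>C a + (b + b') * a"
      by (simp add: xy scaleC_add_left algebra_simps)
    then show "x + y \<in> J"
      using JI complex_vector.subspace_add[OF sub] ij by metis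
  next
    fix x k assume "x \<in> J"
    then obtain i b c where i: "i \<in> I" and x: "x = i + c *\<^sub>C a + b * a"
      by (auto simp: J_def)
    have "k *\<^sub>C x = k *\<^sub>C i + (k * c) *\<^sub>C a + (k *\<^sub>C b) * a"
      by (simp add: x scaleC_add_right scaleC_scaleC mult_scaleC_left)
    then show "k *\<^sub>C x \<in> J"
      using JI complex_vector.subspace_scale[OF sub i] by metis
  next
    fix d x assume "x \<in> J"
    then obtain i b c where i: "i \<in> I" and x: "x = i + c *\<^sub>C a + b * a"
      by (auto simp: J_def)
    have "d * x = d * i + 0 *\<^sub>C a + (c *\<^sub>C d + d * b) * a"
      by (simp add: x algebra_simps mult_scaleC_left mult_scaleC_right)
    then show "d * x \<in> J"
      using JI mult[OF i] by metis
  qed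
  moreover have "I \<subseteq> J"
    using JI[of _ 0 0] by auto
  moreover have "a \<in> J"
    using JI[OF complex_vector.subspace_0[OF sub], of 1 0] by (simp add: scaleC_one)
  ultimately have "J = UNIV"
    using max \<open>a \<notin> I\<close> unfolding maximal_modular_ideal_def by blast
  then have "e \<in> J" by simp
  then obtain i b c where i: "i \<in> I" and e_eq: "e = i + c *\<^sub>C a + b * a"
    unfolding J_def by blast
  define P where "P x = c *\<^sub>C x + b * x" for x
  have P_mult: "P x * y = P (x * y)" for x y
    by (simp add: P_def distrib_right mult_scaleC_left mult.assoc)
  have comm: "P (a * x) = a * P x" for x
    by (simp add: P_def algebra_simps mult_scaleC_left mult_scaleC_right)
  have bound: "norm (P x) \<le> (cmod c + norm b) * norm x" for x
    unfolding P_def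
    by (rule norm_triangle_le) (simp add: norm_scaleC distrib_right norm_mult_ineq)
  have "P a \<in> quasinilpotent_part (\<lambda>x. P (a * x))"
  proof (rule quasinilpotent_part_image[where S = P, OF _ _ bound])
    show "a \<in> quasinilpotent_part (\<lambda>x. P (a * x))"
      by (rule quasinilpotent_part_compose[OF a, where S = P]) (rule comm bound | simp)+
  qed (simp add: comm)
  then have "P a \<in> quasinilpotent_part ((*) (P a))"
    by (simp only: P_mult[symmetric])
  then obtain y where y: "P a = y - y * P a"
    by (rule quasinilpotent_imp_quasiregular)
  have "e - P a \<in> I"
    using i by (simp add: e_eq P_def)
  with ideal_UNIV_if_quasiregular[OF I e] y proper show False
    by blast
qed

lemma semisimple_quasinilpotent_eq_0:
  fixes a :: "'a::comm_complex_banach_algebra"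
  assumes "semisimple TYPE('a)" "a \<in> quasinilpotent_part ((*) a)"
  shows "a = 0"
  using quasinilpotent_in_jacobson_radical[OF assms(2)] assms(1)
  unfolding semisimple_def by blast

section \<open>The closed graph theorem\<close>

text \<open>By the Baire category theorem, some closure of \<open>{x. norm (T x) \<le> n}\<close> contains a ball;
  translating and rescaling this ball gives approximate preimages with a uniform bound.\<close>

lemma linear_approximately_bounded:
  fixes T :: "'a::banach \<Rightarrow> 'b::real_normed_vector"
  assumes T: "linear T"
  obtains C where "0 \<le> C"
    and "\<And>x e. 0 < e \<Longrightarrow> \<exists>w. norm (x - w) < e \<and> norm (T w) \<le> C * norm x"
proof -
  define S where "S n = {x. norm (T x) \<le> real n}" for n
  have "\<exists>n. interior (closure (S n)) \<noteq> {}"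
  proof (rule ccontr)
    assume "\<not> ?thesis"
    then have "euclidean interior_of \<Union> (range (\<lambda>n. closure (S n))) = {}"
      by (intro Baire_category_alt) (auto simp: completely_metrizable_space_euclidean)
    moreover have "\<Union> (range (\<lambda>n. closure (S n))) = UNIV"
    proof -
      have "x \<in> S (nat \<lceil>norm (T x)\<rceil>)" for x
        by (simp add: S_def real_nat_ceiling_ge)
      then show ?thesis using closure_subset by blast
    qed
    ultimately show False by simp
  qed
  then obtain n x0 where "x0 \<in> interior (closure (S n))" by auto
  then obtain r where r: "0 < r" and ball: "ball x0 r \<subseteq> closure (S n)"
    by (auto simp: mem_interior)
  have small: "\<exists>w. norm (x - w) < e \<and> norm (T w) \<le> 2 * real n"
    if x: "norm x < r" and e: "0 < e" for x e
  proof -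
    have "x0 + x \<in> closure (S n)" "x0 \<in> closure (S n)"
      using ball x r by (auto simp: dist_norm)
    moreover have "0 < e / 2" using e by simp
    ultimately obtain u v where u: "u \<in> S n" "dist u (x0 + x) < e / 2"
      and v: "v \<in> S n" "dist v x0 < e / 2"
      unfolding closure_approachable by meson
    have "x - (u - v) = (v - x0) - (u - (x0 + x))" by simp
    also have "norm \<dots> \<le> norm (v - x0) + norm (u - (x0 + x))"
      by (rule norm_triangle_ineq4)
    finally have "norm (x - (u - v)) < e"
      using u(2) v(2) unfolding dist_norm by linarith
    moreover have "norm (T (u - v)) \<le> 2 * real n"
      using norm_triangle_ineq4[of "T u" "T v"] u(1) v(1)
      by (simp add: S_def linear_diff[OF T])
    ultimately show ?thesis by blast
  qed
  show ?thesis
  proof (rule that)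
    show "0 \<le> 4 * real n / r" using r by simp
  next
    fix x :: 'a and e :: real assume e: "0 < e"
    show "\<exists>w. norm (x - w) < e \<and> norm (T w) \<le> 4 * real n / r * norm x"
    proof (cases "x = 0")
      case True
      then show ?thesis using e linear_0[OF T] by (intro exI[of _ 0]) simp
    next
      case False
      define c where "c = r / (2 * norm x)"
      have c: "0 < c" using False r by (simp add: c_def)
      have "norm (c *\<^sub>R x) < r" using False r by (simp add: c_def)
      from small[OF this, of "c * e"] c e obtain w
        where w: "norm (c *\<^sub>R x - w) < c * e" "norm (T w) \<le> 2 * real n" by auto
      have "c *\<^sub>R (x - w /\<^sub>R c) = c *\<^sub>R x - w" using c by (simp add: scaleR_diff_right)
      then have "c * norm (x - w /\<^sub>R c) = norm (c *\<^sub>R x - w)"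
        using c by (metis abs_of_pos norm_scaleR)
      then have "c * norm (x - w /\<^sub>R c) < c * e" using w(1) by simp
      then have "norm (x - w /\<^sub>R c) < e" using c by simp
      moreover have "norm (T (w /\<^sub>R c)) \<le> 4 * real n / r * norm x"
      proof -
        have "norm (T (w /\<^sub>R c)) = norm (T w) / c"
          using c by (simp add: linear_scale[OF T] divide_inverse mult.commute)
        also have "\<dots> \<le> 2 * real n / c"
          using w(2) c by (simp add: divide_right_mono)
        also have "\<dots> = 4 * real n / r * norm x"
          using r False by (simp add: c_def)
        finally show ?thesis .
      qed
      ultimately show ?thesis by blast
    qed
  qed
qed

text \<open>Successive approximation writes \<open>x\<close> as a series \<open>\<Sum>w\<^sub>k\<close> with \<open>norm (T w\<^sub>k)\<close> decreasing
  geometrically; closedness of the graph identifies \<open>T x\<close> with \<open>\<Sum>T w\<^sub>k\<close>.\<close>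

theorem closed_graph_bounded_linear:
  fixes T :: "'a::banach \<Rightarrow> 'b::banach"
  assumes T: "linear T"
    and graph: "\<And>s x y. s \<longlonglongrightarrow> x \<Longrightarrow> (\<lambda>n. T (s n)) \<longlonglongrightarrow> y \<Longrightarrow> T x = y"
  shows "bounded_linear T"
proof -
  obtain C where C: "0 \<le> C"
    and "\<And>x e. 0 < e \<Longrightarrow> \<exists>w. norm (x - w) < e \<and> norm (T w) \<le> C * norm x"
    using linear_approximately_bounded[OF T] by blast
  then have "\<forall>x e. \<exists>w. 0 < e \<longrightarrow> norm (x - w) < e \<and> norm (T w) \<le> C * norm x"
    by blast
  then obtain W where W: "\<And>x e. 0 < e \<Longrightarrow> norm (x - W x e) < e"
    "\<And>x e. 0 < e \<Longrightarrow> norm (T (W x e)) \<le> C * norm x"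
    by metis
  have "norm (T x) \<le> norm x * (2 * C)" for x
  proof (cases "x = 0")
    case True
    then show ?thesis using linear_0[OF T] by simp
  next
    case False
    define r where "r = rec_nat x (\<lambda>k z. z - W z (norm x / 2 ^ Suc k))"
    define w where "w k = W (r k) (norm x / 2 ^ Suc k)" for k
    have r0: "r 0 = x" and rS: "r (Suc k) = r k - w k" for k
      by (simp_all add: r_def w_def)
    have pos: "0 < norm x / 2 ^ k" for k using False by simp
    have rle: "norm (r k) \<le> norm x / 2 ^ k" for k
    proof (cases k)
      case (Suc j)
      then show ?thesis using W(1)[OF pos[of "Suc j"], of "r j"] by (simp add: rS w_def)
    qed (simp add: r0)
    have Tw: "norm (T (w k)) \<le> C * norm x * (1 / 2) ^ k" for k
    proof -
      have "norm (T (w k)) \<le> C * norm (r k)"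
        unfolding w_def by (rule W(2)[OF pos])
      also have "\<dots> \<le> C * (norm x / 2 ^ k)" by (rule mult_left_mono[OF rle C])
      finally show ?thesis by (simp add: power_one_over)
    qed
    have partial: "(\<Sum>k<n. w k) = x - r n" for n
      by (induction n) (simp_all add: r0 rS)
    have "r \<longlonglongrightarrow> 0"
    proof (rule Lim_null_comparison)
      show "\<forall>\<^sub>F n in sequentially. norm (r n) \<le> norm x / 2 ^ n" using rle by simp
      have "(\<lambda>n. norm x * (1 / 2) ^ n) \<longlonglongrightarrow> norm x * 0"
        by (intro tendsto_mult tendsto_const LIMSEQ_power_zero) simp
      then show "(\<lambda>n. norm x / 2 ^ n) \<longlonglongrightarrow> 0" by (simp add: power_one_over)
    qed
    then have "(\<lambda>n. \<Sum>k<n. w k) \<longlonglongrightarrow> x"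
      unfolding partial using tendsto_diff[OF tendsto_const[of x]] by fastforce
    moreover
    have geom: "(\<lambda>k. C * norm x * (1 / 2) ^ k) sums (C * norm x * 2)"
      using sums_mult[OF geometric_sums[of "1 / 2 :: real"], of "C * norm x"] by simp
    then have sm: "summable (\<lambda>k. T (w k))"
      using Tw by (intro summable_comparison_test'[OF sums_summable[OF geom]]) simp
    then have "(\<lambda>n. T (\<Sum>k<n. w k)) \<longlonglongrightarrow> (\<Sum>k. T (w k))"
      unfolding linear_sum[OF T] by (rule summable_LIMSEQ)
    ultimately have "T x = (\<Sum>k. T (w k))" by (rule graph)
    also have "norm \<dots> \<le> (\<Sum>k. C * norm x * (1 / 2) ^ k)"
      by (rule norm_suminf_le[OF Tw sums_summable[OF geom]])
    also have "\<dots> = norm x * (2 * C)"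
      using geom by (simp add: sums_iff)
    finally show ?thesis .
  qed
  then show ?thesis
    by (intro bounded_linear_intro[where K = "2 * C"])
      (simp_all add: linear_add[OF T] linear_scale[OF T])
qed

section \<open>Multipliers of semi-simple algebras\<close>

text \<open>An element annihilating the algebra has square zero, so it is quasinilpotent. Hence
  identities between elements may be tested after multiplication by an arbitrary element.\<close>

lemma semisimple_mult_cancel:
  fixes a b :: "'a::comm_complex_banach_algebra"
  assumes ss: "semisimple TYPE('a)" and eq: "\<And>z. a * z = b * z"
  shows "a = b"
proof -
  have "(a - b) * z = 0" for z using eq by (simp add: left_diff_distrib)
  then have "a - b \<in> quasinilpotent_part ((*) (a - b))"
    by (intro nilpotent_in_quasinilpotent_part) simp_all
  from semisimple_quasinilpotent_eq_0[OF ss this] show ?thesis by simp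
qed

lemma multiplier_bounded_linear:
  fixes T :: "'a::comm_complex_banach_algebra \<Rightarrow> 'a"
  assumes ss: "semisimple TYPE('a)" and "multiplier T"
  shows "bounded_linear T"
proof (rule closed_graph_bounded_linear)
  have T: "T x * y = x * T y" for x y
    using \<open>multiplier T\<close> by (simp add: multiplier_def)
  show "linear T"
  proof (rule linearI)
    show "T (x + y) = T x + T y" for x y
      by (rule semisimple_mult_cancel[OF ss]) (simp add: T distrib_right)
    show "T (r *\<^sub>R x) = r *\<^sub>R T x" for r x
      by (rule semisimple_mult_cancel[OF ss]) (simp add: T)
  qed
  fix s x y assume s: "s \<longlonglongrightarrow> x" and Ts: "(\<lambda>n. T (s n)) \<longlonglongrightarrow> y"
  show "T x = y"
  proof (rule semisimple_mult_cancel[OF ss])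
    fix z
    have "(\<lambda>n. s n * T z) \<longlonglongrightarrow> x * T z" by (intro tendsto_intros s)
    moreover have "(\<lambda>n. T (s n) * z) \<longlonglongrightarrow> y * z" by (intro tendsto_intros Ts)
    ultimately show "T x * z = y * z"
      unfolding T by (rule LIMSEQ_unique)
  qed
qed

text \<open>Multiplication by \<open>T x\<close> is the composition of \<open>T\<close> with multiplication by \<open>x\<close>, and the two
  commute; so \<open>T x\<close> is a quasinilpotent element whenever \<open>x\<close> is in the quasinilpotent part
  of \<open>T\<close>.\<close>

lemma quasinilpotent_part_multiplier:
  fixes T :: "'a::comm_complex_banach_algebra \<Rightarrow> 'a"
  assumes ss: "semisimple TYPE('a)" and mT: "multiplier T"
  shows "quasinilpotent_part T = {x. T x = 0}"
proof (intro equalityI subsetI CollectI)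
  interpret T: bounded_linear T by (rule multiplier_bounded_linear[OF ss mT])
  {
    fix x assume x: "x \<in> quasinilpotent_part T"
    have T: "T x * y = x * T y" for x y
      using mT by (simp add: multiplier_def)
    have comm: "x * T y = T (x * y)" for y
    proof (rule semisimple_mult_cancel[OF ss])
      fix z
      have "(x * T y) * z = x * (y * T z)" by (simp add: T mult.assoc)
      also have "\<dots> = T (x * y) * z" by (simp add: T mult.assoc)
      finally show "(x * T y) * z = T (x * y) * z" .
    qed
    have qx: "x \<in> quasinilpotent_part (\<lambda>y. x * T y)"
      by (rule quasinilpotent_part_compose[OF x comm norm_mult_ineq]) simp
    obtain K where K: "\<And>y. norm (T y) \<le> K * norm y"
      using T.bounded by (metis mult.commute)
    have "T x \<in> quasinilpotent_part (\<lambda>y. x * T y)"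
      by (rule quasinilpotent_part_image[OF qx _ K]) (simp add: comm)
    then have "T x \<in> quasinilpotent_part ((*) (T x))"
      by (simp only: T[symmetric])
    then show "T x = 0" by (rule semisimple_quasinilpotent_eq_0[OF ss])
  next
    fix x assume "x \<in> {x. T x = 0}"
    then show "x \<in> quasinilpotent_part T"
      by (intro nilpotent_in_quasinilpotent_part) (simp_all add: T.zero)
  }
qed

section \<open>Decompositions\<close>

text \<open>Boundedness guarantees that the supremum in \<^const>\<open>onorm_on\<close> is taken over a bounded set,
  so that it dominates each of its quotients.\<close>

lemma quasinilpotent_on_subset_quasinilpotent_part:
  fixes T :: "'a::complex_banach \<Rightarrow> 'a"
  assumes bl: "bounded_linear T" and N: "quasinilpotent_on N T"
  shows "N \<subseteq> quasinilpotent_part T"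
proof
  fix x assume x: "x \<in> N"
  obtain K where K: "0 \<le> K" "\<And>y. norm (T y) \<le> K * norm y"
    using bounded_linear.nonneg_bounded[OF bl] by (metis mult.commute)
  have bdd: "bdd_above ((\<lambda>y. norm ((T ^^ n) y) / norm y) ` N)" for n
  proof (rule bdd_aboveI2)
    fix y
    show "norm ((T ^^ n) y) / norm y \<le> K ^ n"
    proof (cases "y = 0")
      case False
      then show ?thesis
        using funpow_norm_le[of T K n y] K by (simp add: divide_le_eq)
    qed (use K in simp)
  qed
  have quot: "norm ((T ^^ n) x) / norm x \<le> onorm_on N (T ^^ n)" for n
    unfolding onorm_on_def by (rule cSUP_upper[OF x bdd])
  have nonneg: "0 \<le> onorm_on N (T ^^ n)" for n
    by (rule order_trans[OF _ quot]) simp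
  have "norm ((T ^^ n) x) \<le> norm x * 1 ^ n * onorm_on N (T ^^ n)" for n
  proof (cases "x = 0")
    case True
    then show ?thesis using funpow_norm_le[of T K n x] K by simp
  next
    case False
    then show ?thesis using quot[of n] by (simp add: divide_le_eq mult.commute)
  qed
  then show "x \<in> quasinilpotent_part T"
    unfolding quasinilpotent_part_def mem_Collect_eq
    by (intro root_tendsto_0_majorant[OF N[unfolded quasinilpotent_on_def],
          where C = "norm x" and K = 1])
      (use nonneg in auto)
qed

lemma quasinilpotent_on_kernel:
  fixes T :: "'a::complex_banach \<Rightarrow> 'a"
  assumes T0: "T 0 = 0" and N: "\<And>x. x \<in> N \<Longrightarrow> T x = 0" "N \<noteq> {}"
  shows "quasinilpotent_on N T"
proof -
  have "onorm_on N (T ^^ n) = 0" if n: "0 < n" for n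
  proof -
    have "(T ^^ n) x = 0" if "x \<in> N" for x
      using funpow_eq_zero[of T x n] T0 N(1)[OF that] n by simp
    then show ?thesis using N(2) by (simp add: onorm_on_def)
  qed
  then have "\<forall>\<^sub>F n in sequentially. root n (onorm_on N (T ^^ n)) = 0"
    by (intro eventually_mono[OF eventually_gt_at_top[of 0]]) simp
  then show ?thesis
    unfolding quasinilpotent_on_def by (rule tendsto_eventually)
qed

theorem proposition3p3:
  fixes T :: "'a::comm_complex_banach_algebra \<Rightarrow> 'a"
  assumes "semisimple TYPE('a)"
    and "multiplier T"
  shows "pseudo_fredholm T \<longleftrightarrow> left_generalized_drazin_invertible T"
proof -
  interpret T: bounded_linear T by (rule multiplier_bounded_linear[OF assms])
  note H0 = quasinilpotent_part_multiplier[OF assms]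
  show ?thesis
  proof
    assume "pseudo_fredholm T"
    then obtain M N where M: "invariant_closed_subspace T M" and N: "invariant_closed_subspace T N"
      and MN: "is_direct_sum M N" and sr: "semi_regular_on M T" and qn: "quasinilpotent_on N T"
      by (auto simp: pseudo_fredholm_def)
    have N_ker: "T x = 0" if "x \<in> N" for x
      using quasinilpotent_on_subset_quasinilpotent_part[OF T.bounded_linear_axioms qn] that H0
      by auto
    have M_inj: "x = 0" if x: "x \<in> M" "T x = 0" for x
    proof -
      have "x \<in> (T ^^ 1) ` M"
        using sr x unfolding semi_regular_on_def by blast
      then obtain y where y: "x = T y" by auto
      \<comment> \<open>An element killed by \<open>T\<^sup>2\<close> is in \<open>H\<^sub>0(T)\<close>, so it is already killed by \<open>T\<close>.\<close>
      then have "y \<in> quasinilpotent_part T"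
        using x(2) by (intro nilpotent_in_quasinilpotent_part) (simp_all add: T.zero)
      then show "x = 0" using y H0 by simp
    qed
    have "quasinilpotent_part T = N"
    proof (intro equalityI subsetI)
      fix x assume "x \<in> quasinilpotent_part T"
      then have Tx: "T x = 0" using H0 by simp
      have "x \<in> M + N" using MN by (simp add: is_direct_sum_def)
      then obtain m n where mn: "m \<in> M" "n \<in> N" and x: "x = m + n"
        by (auto elim: set_plus_elim)
      then have "T m = 0" using Tx N_ker[OF mn(2)] by (simp add: T.add)
      then have "m = 0" by (rule M_inj[OF mn(1)])
      then show "x \<in> N" using mn x by simp
    qed (simp add: H0 N_ker)
    moreover have "is_direct_sum N M"
      using MN by (simp add: is_direct_sum_def add.commute Int_commute)
    ultimately show "left_generalized_drazin_invertible T"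
      using M N sr
      unfolding left_generalized_drazin_invertible_def invariant_closed_subspace_def
        semi_regular_on_def
      by auto
  next
    assume "left_generalized_drazin_invertible T"
    then obtain M where cl: "closed (quasinilpotent_part T)"
      and M: "invariant_closed_subspace T M"
      and sum: "is_direct_sum (quasinilpotent_part T) M" and clM: "closed (T ` M)"
      by (auto simp: left_generalized_drazin_invertible_def)
    let ?N = "quasinilpotent_part T"
    have scaleC: "T (c *\<^sub>C x) = c *\<^sub>C T x" for c x
      by (rule semisimple_mult_cancel[OF assms(1)])
        (use assms(2) in \<open>simp add: multiplier_def mult_scaleC_left\<close>)
    have N: "invariant_closed_subspace T ?N"
      unfolding invariant_closed_subspace_def
    proof (intro conjI cl complex_vector.subspaceI)
    qed (auto simp: H0 T.zero T.add scaleC)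
    have subM: "complex_vector.subspace M"
      using M by (simp add: invariant_closed_subspace_def)
    have powM: "0 \<in> (T ^^ n) ` M" for n
    proof -
      have "(T ^^ n) 0 = 0" by (induction n) (simp_all add: T.zero)
      then show ?thesis using complex_vector.subspace_0[OF subM] by force
    qed
    have "{x \<in> M. T x = 0} \<subseteq> {0}"
      using sum by (auto simp: is_direct_sum_def H0)
    then have "semi_regular_on M T"
      using clM powM unfolding semi_regular_on_def by blast
    moreover have "quasinilpotent_on ?N T"
    proof (rule quasinilpotent_on_kernel)
      have "0 \<in> ?N" by (simp add: H0 T.zero)
      then show "?N \<noteq> {}" by blast
    qed (simp_all add: H0 T.zero)
    moreover have "is_direct_sum M ?N"
      using sum by (simp add: is_direct_sum_def add.commute Int_commute)
    ultimately show "pseudo_fredholm T"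
      using M N unfolding pseudo_fredholm_def by blast
  qed
qed

end
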